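(* Let $F\subset\mathbb{R}^2$ be a compact set. (i) If $F$ is weak-bilinearly separated, then $$\overline{\dim_{\mathrm{B}}}\,\Delta(F)\geq \frac{3}{2}\,\underline{\dim_{\mathrm{B}}}\,F.$$ (ii) If $F$ is strong-bilinearly separated, then $$\underline{\dim_{\mathrm{B}}}\,\Delta(F)\geq \frac{3}{2}\,\underline{\dim_{\mathrm{B}}}\,F\quad\text{and}\quad \overline{\dim_{\mathrm{B}}}\,\Delta(F)\geq \frac{3}{2}\,\overline{\dim_{\mathrm{B}}}\,F.$$
   Context: For $F\subset\mathbb{R}^2$, the triangle set of $F$ is $$\Delta(F)=\{(r_1,r_2,r_3)\in[0,\infty)^3: \exists\, x,y,z\in F,\ r_1=|x-y|,\ r_2=|z-y|,\ r_3=|x-z|\}\subset\mathbb{R}^3,$$ where $|\cdot|$ is the Euclidean norm (the points $x,y,z$ need not be distinct). For a bounded set $A\subset\mathbb{R}^n$ and $\delta>0$, $N_\delta(A)$ denotes the minimal number of cubes of side length $\delta$ needed to cover $A$. The upper and lower box dimensions are $$\overline{\dim_{\mathrm{B}}}\,A=\limsup_{\delta\to0}\left(-\frac{\log N_\delta(A)}{\log\delta}\right),\qquad \underline{\dim_{\mathrm{B}}}\,A=\liminf_{\delta\to0}\left(-\frac{\log N_\delta(A)}{\log\delta}\right).$$ A set $F\subset\mathbb{R}^2$ is weak-bilinearly separated if there exist three disjoint sets $F_1,F_2,F_3$ with $F_1\cup F_2\cup F_3\subset F$ such that: (1) $\min\{\underline{\dim_{\mathrm{B}}}F_1,\underline{\dim_{\mathrm{B}}}F_2,\underline{\dim_{\mathrm{B}}}F_3\}=\underline{\dim_{\mathrm{B}}}F$;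 (2) there is a number $r>0$ such that for every triple $(x,y,z)\in F_1\times F_2\times F_3$, $$|\langle x-y,y-z\rangle|=|x-y|\,|y-z|\,|\sin\theta(x-y,y-z)|>r,$$ where $\langle\cdot,\cdot\rangle$ denotes the Euclidean outer product (so that $|\langle u,v\rangle|=|u_1v_2-u_2v_1|$ for $u,v\in\mathbb{R}^2$) and $\theta(x-y,y-z)$ is the angle spanned by $x-y$ and $y-z$. $F$ is strong-bilinearly separated if the same holds with (1) replaced by the following stronger condition: (1') there is a constant $M>0$ such that for all $\delta\in(0,1)$, $N_\delta(F)\leq M\min\{N_\delta(F_1),N_\delta(F_2),N_\delta(F_3)\}$. *)

theory Defs
  imports "HOL-Analysis.Analysis"
begin

text \<open>
  Cubes are closed and axis-parallel, at arbitrary position. The number is meaningful only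
  for bounded sets and positive side length; every set it is applied to below is bounded.
\<close>

definition cube :: "'a \<Rightarrow> real \<Rightarrow> 'a::euclidean_space set" where
  "cube a \<delta> = cbox a (a + \<delta> *\<^sub>R One)"

definition covering_number :: "real \<Rightarrow> 'a::euclidean_space set \<Rightarrow> nat" where
  "covering_number \<delta> A =
     (LEAST n. \<exists>P. finite P \<and> card P = n \<and> A \<subseteq> (\<Union>a\<in>P. cube a \<delta>))"

text \<open>
  The quotient is taken in the extended reals with the usual convention that the logarithm of
  zero is minus infinity (in HOL, ln 0 = 0), so that for \<open>0 < \<delta> < 1\<close> an empty set
  gets the value minus infinity.
\<close>

definition box_quotient :: "'a::euclidean_space set \<Rightarrow> real \<Rightarrow> ereal" where
  "box_quotient A \<delta> =
     (if covering_number \<delta> A = 0 then - \<infinity>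
      else ereal (- (ln (real (covering_number \<delta> A)) / ln \<delta>)))"

definition upper_box_dim :: "'a::euclidean_space set \<Rightarrow> ereal" where
  "upper_box_dim A = Limsup (at_right 0) (box_quotient A)"

definition lower_box_dim :: "'a::euclidean_space set \<Rightarrow> ereal" where
  "lower_box_dim A = Liminf (at_right 0) (box_quotient A)"

definition triangle_set :: "(real^2) set \<Rightarrow> (real^3) set" where
  "triangle_set F =
     {r. (\<forall>i. 0 \<le> r $ i) \<and>
         (\<exists>x\<in>F. \<exists>y\<in>F. \<exists>z\<in>F.
            r $ 1 = norm (x - y) \<and> r $ 2 = norm (z - y) \<and> r $ 3 = norm (x - z))}"

definition outer_product :: "real^2 \<Rightarrow> real^2 \<Rightarrow> real" where
  "outer_product u v = u $ 1 * v $ 2 - u $ 2 * v $ 1"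

definition bilinearly_separated_triple ::
    "(real^2) set \<Rightarrow> (real^2) set \<Rightarrow> (real^2) set \<Rightarrow> (real^2) set \<Rightarrow> bool" where
  "bilinearly_separated_triple F F1 F2 F3 \<longleftrightarrow>
     F1 \<inter> F2 = {} \<and> F1 \<inter> F3 = {} \<and> F2 \<inter> F3 = {} \<and> F1 \<union> F2 \<union> F3 \<subseteq> F \<and>
     (\<exists>r>0. \<forall>x\<in>F1. \<forall>y\<in>F2. \<forall>z\<in>F3. \<bar>outer_product (x - y) (y - z)\<bar> > r)"

definition weak_bilinearly_separated :: "(real^2) set \<Rightarrow> bool" where
  "weak_bilinearly_separated F \<longleftrightarrow>
     (\<exists>F1 F2 F3. bilinearly_separated_triple F F1 F2 F3 \<and>
        Min {lower_box_dim F1, lower_box_dim F2, lower_box_dim F3} = lower_box_dim F)"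

definition strong_bilinearly_separated :: "(real^2) set \<Rightarrow> bool" where
  "strong_bilinearly_separated F \<longleftrightarrow>
     (\<exists>F1 F2 F3. bilinearly_separated_triple F F1 F2 F3 \<and>
        (\<exists>M>0. \<forall>\<delta>\<in>{0<..<1}.
           real (covering_number \<delta> F) \<le>
             M * real (Min {covering_number \<delta> F1, covering_number \<delta> F2, covering_number \<delta> F3})))"

end

theory Submission
  imports Defs
begin

text \<open>
  Fix \<open>x \<in> F1\<close> and \<open>z \<in> F3\<close>, and at scale \<open>\<delta>\<close> let \<open>a\<close> and \<open>b\<close> be the numbers of different
  distances from \<open>x\<close> and from \<open>z\<close> to the points of \<open>F2\<close>. Because the triangles have area bounded
  below, a point is determined by its distances to two others, up to a reflection and in a
  Lipschitz way. Hence \<open>N(F2) \<lesssim> a b\<close>. Likewise, each of the \<open>a\<close> lengths of a side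
  \<open>xy\<close> contributes about \<open>N(F3)\<close> cubes to the triangle set, so \<open>N(\<Delta>) \<gtrsim> a N(F3)\<close>, and by symmetry
  \<open>N(\<Delta>) \<gtrsim> b N(F1)\<close>. Multiplying gives \<open>N(F1) N(F2) N(F3) \<lesssim> N(\<Delta>)\<^sup>2\<close>.
\<close>

section \<open>Covering numbers\<close>

lemma covering_number_le_card:
  assumes "finite P" "A \<subseteq> (\<Union>a\<in>P. cube a \<delta>)"
  shows "covering_number \<delta> A \<le> card P"
  unfolding covering_number_def by (rule Least_le) (use assms in blast)

lemma covering_number_empty [simp]: "covering_number \<delta> {} = 0"
  using covering_number_le_card[of "{}" "{}" \<delta>] by simp

lemma mem_cube_iff:
  "x \<in> cube a \<delta> \<longleftrightarrow> (\<forall>b\<in>Basis. a \<bullet> b \<le> x \<bullet> b \<and> x \<bullet> b \<le> a \<bullet> b + \<delta>)"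
  by (auto simp: cube_def mem_box inner_add_left)

text \<open>Scaling and translation reduce the claim to a cover of one ball of radius
  \<open>K\<close>, so a single offset set \<open>Q\<close> serves all centres and all scales.
  Constants independent of \<delta> originate here.\<close>

lemma cball_cover_by_cubes:
  fixes K :: real
  obtains Q :: "'a::euclidean_space set" where "finite Q"
    "\<And>w \<delta>. \<delta> > 0 \<Longrightarrow> cball w (K * \<delta>) \<subseteq> (\<Union>q\<in>Q. cube (w + \<delta> *\<^sub>R q) \<delta>)"
proof -
  obtain k where k: "finite k" "cball (0::'a) K \<subseteq> (\<Union>x\<in>k. ball x (1/2))"
    using compact_cball[of "0::'a" K] compact_eq_totally_bounded[of "cball (0::'a) K"]
    by (metis half_gt_zero zero_less_one)
  \<comment> \<open>The ball of radius 1/2 about \<open>x\<close> fits into the unit cube centred at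
    \<open>x\<close>, whose lower corner is \<open>x\<close> shifted by half of
    \<open>One\<close>.\<close>
  define Q where "Q = (\<lambda>x. x - (1/2) *\<^sub>R One) ` k"
  have "cball w (K * \<delta>) \<subseteq> (\<Union>q\<in>Q. cube (w + \<delta> *\<^sub>R q) \<delta>)" if "\<delta> > 0" for w \<delta>
  proof
    fix v assume v: "v \<in> cball w (K * \<delta>)"
    define u where "u = (1 / \<delta>) *\<^sub>R (v - w)"
    have v_eq: "v = w + \<delta> *\<^sub>R u" using that by (simp add: u_def)
    have "norm u \<le> K"
      using v that by (simp add: u_def dist_norm norm_minus_commute pos_divide_le_eq)
    then obtain x where x: "x \<in> k" "dist x u < 1/2" using k by auto
    have "x \<bullet> b - 1/2 \<le> u \<bullet> b \<and> u \<bullet> b \<le> x \<bullet> b + 1/2" if "b \<in> Basis" for b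
    proof -
      have "\<bar>(x - u) \<bullet> b\<bar> \<le> norm (x - u)" using that by (rule Basis_le_norm)
      then show ?thesis using x unfolding inner_diff_left dist_norm by linarith
    qed
    moreover have "(x - (1/2) *\<^sub>R One) \<bullet> b = x \<bullet> b - 1/2" if "b \<in> Basis" for b
      using that by (simp add: inner_diff_left)
    ultimately have "v \<in> cube (w + \<delta> *\<^sub>R (x - (1/2) *\<^sub>R One)) \<delta>"
      unfolding mem_cube_iff v_eq
    proof (intro ballI)
      fix b :: 'a assume b: "b \<in> Basis"
      assume H: "\<And>b. b \<in> Basis \<Longrightarrow> x \<bullet> b - 1/2 \<le> u \<bullet> b \<and> u \<bullet> b \<le> x \<bullet> b + 1/2"
        "\<And>b. b \<in> Basis \<Longrightarrow> (x - (1/2) *\<^sub>R One) \<bullet> b = x \<bullet> b - 1/2"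
      have "\<delta> * (x \<bullet> b - 1/2) \<le> \<delta> * (u \<bullet> b)" "\<delta> * (u \<bullet> b) \<le> \<delta> * (x \<bullet> b + 1/2)"
        using H(1)[OF b] \<open>\<delta> > 0\<close> by simp_all
      then show "(w + \<delta> *\<^sub>R (x - (1/2) *\<^sub>R One)) \<bullet> b \<le> (w + \<delta> *\<^sub>R u) \<bullet> b \<and>
          (w + \<delta> *\<^sub>R u) \<bullet> b \<le> (w + \<delta> *\<^sub>R (x - (1/2) *\<^sub>R One)) \<bullet> b + \<delta>"
        unfolding inner_add_left inner_scaleR_left H(2)[OF b] by (simp add: algebra_simps)
    qed
    then show "v \<in> (\<Union>q\<in>Q. cube (w + \<delta> *\<^sub>R q) \<delta>)" using x by (auto simp: Q_def)
  qed
  with k(1) show ?thesis by (intro that[of Q]) (auto simp: Q_def)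
qed

text \<open>A bounded set has some finite cover by cubes, so the \<open>LEAST\<close> is a genuine
  minimum and not an arbitrary number.\<close>

lemma covering_number_attained:
  fixes A :: "'a::euclidean_space set"
  assumes "bounded A" "\<delta> > 0"
  obtains P where "finite P" "card P = covering_number \<delta> A" "A \<subseteq> (\<Union>a\<in>P. cube a \<delta>)"
proof -
  obtain e where e: "A \<subseteq> cball 0 e" using assms(1) by (auto simp: bounded_iff subset_iff)
  obtain Q :: "'a set" where Q: "finite Q"
    "cball 0 (e / \<delta> * \<delta>) \<subseteq> (\<Union>q\<in>Q. cube (0 + \<delta> *\<^sub>R q) \<delta>)"
    using cball_cover_by_cubes[of "e / \<delta>"] assms(2) by metis
  have "\<exists>P. finite P \<and> card P = card ((\<lambda>q. \<delta> *\<^sub>R q) ` Q) \<and> A \<subseteq> (\<Union>a\<in>P. cube a \<delta>)"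
    using Q e assms(2) by (intro exI[of _ "(\<lambda>q. \<delta> *\<^sub>R q) ` Q"]) auto
  then have "\<exists>P. finite P \<and> card P = covering_number \<delta> A \<and> A \<subseteq> (\<Union>a\<in>P. cube a \<delta>)"
    unfolding covering_number_def by (rule LeastI)
  then show ?thesis using that by blast
qed

lemma covering_number_pos:
  assumes "bounded A" "\<delta> > 0" "A \<noteq> {}"
  shows "covering_number \<delta> A > 0"
  by (rule covering_number_attained[OF assms(1,2)]) (use assms(3) in fastforce)

text \<open>Points sharing a label lie in one ball of radius \<open>K * \<delta>\<close>, which
  takes a fixed number of cubes; bounding a covering number thus becomes counting labels. The factor
  \<open>m\<close> is chosen before the set, the scale and the labelling.\<close>

lemma covering_number_le_labels:
  fixes K :: real
  obtains m :: nat where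
    "\<And>(A :: 'a::euclidean_space set) \<delta> (g :: 'a \<Rightarrow> 'b) L. \<delta> > 0 \<Longrightarrow> finite L \<Longrightarrow> g ` A \<subseteq> L \<Longrightarrow>
       (\<And>w w'. w \<in> A \<Longrightarrow> w' \<in> A \<Longrightarrow> g w = g w' \<Longrightarrow> dist w w' \<le> K * \<delta>) \<Longrightarrow>
       covering_number \<delta> A \<le> m * card L"
proof -
  obtain Q :: "'a set" where Q: "finite Q"
    "\<And>w \<delta>. \<delta> > 0 \<Longrightarrow> cball w (K * \<delta>) \<subseteq> (\<Union>q\<in>Q. cube (w + \<delta> *\<^sub>R q) \<delta>)"
    using cball_cover_by_cubes by blast
  show ?thesis
  proof (rule that[of "card Q"])
    fix A :: "'a set" and \<delta> and g :: "'a \<Rightarrow> 'b" and L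
    assume H: "\<delta> > 0" "finite L" "g ` A \<subseteq> L"
      "\<And>w w'. w \<in> A \<Longrightarrow> w' \<in> A \<Longrightarrow> g w = g w' \<Longrightarrow> dist w w' \<le> K * \<delta>"
    \<comment> \<open>One representative per label. For a label that no point of \<open>A\<close>
      carries, the value is arbitrary and only adds spare cubes.\<close>
    define c where "c = inv_into A g"
    define P where "P = (\<lambda>(l, q). c l + \<delta> *\<^sub>R q) ` (L \<times> Q)"
    have "finite P" using H(2) Q(1) by (simp add: P_def)
    moreover have "A \<subseteq> (\<Union>a\<in>P. cube a \<delta>)"
    proof
      fix w assume w: "w \<in> A"
      have "c (g w) \<in> A" "g (c (g w)) = g w"
        using w unfolding c_def by (auto intro: inv_into_into f_inv_into_f)
      then have "w \<in> cball (c (g w)) (K * \<delta>)" using H(4)[of "c (g w)" w] w by simp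
      then obtain q where "q \<in> Q" "w \<in> cube (c (g w) + \<delta> *\<^sub>R q) \<delta>"
        using Q(2)[OF H(1)] by blast
      then show "w \<in> (\<Union>a\<in>P. cube a \<delta>)" using w H(3) unfolding P_def by force
    qed
    ultimately have "covering_number \<delta> A \<le> card P" by (rule covering_number_le_card)
    also have "\<dots> \<le> card (L \<times> Q)" unfolding P_def using H(2) Q(1) by (intro card_image_le) simp
    finally show "covering_number \<delta> A \<le> card Q * card L" by (simp add: card_cartesian_product mult.commute)
  qed
qed

section \<open>Recovering a point of the plane from two distances\<close>

text \<open>Relative to the base \<open>v = q - p\<close>, the two distances control the component
  of \<open>w - p\<close> along \<open>v\<close> and, given the orientation, the component across
  it. The sign condition excludes the reflection in the line \<open>pq\<close>, and the area bound
  keeps the base from being short.\<close>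

lemma dist_le_of_distances:
  fixes w w' p q :: "real^2"
  assumes r: "r > 0" and "\<delta> \<ge> 0"
    and R: "dist w p \<le> R" "dist w' p \<le> R" "dist w q \<le> R" "dist w' q \<le> R" "dist p q \<le> R"
    and T: "\<bar>outer_product (w - p) (q - p)\<bar> > r" "\<bar>outer_product (w' - p) (q - p)\<bar> > r"
    and sgn: "(outer_product (w - p) (q - p) > 0) = (outer_product (w' - p) (q - p) > 0)"
    and d: "\<bar>dist w p - dist w' p\<bar> \<le> \<delta>" "\<bar>dist w q - dist w' q\<bar> \<le> \<delta>"
  shows "dist w w' \<le> (R / r * (2 * R + 3 * R^3 / r)) * \<delta>"
proof -
  define u u' v where "u = w - p" and "u' = w' - p" and "v = q - p"
  have R0: "R \<ge> 0" using R(1) zero_le_dist[of w p] by linarith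
  have nu: "norm u \<le> R" "norm u' \<le> R" "norm (u - v) \<le> R" "norm (u' - v) \<le> R" "norm v \<le> R"
    using R by (simp_all add: u_def u'_def v_def dist_norm norm_minus_commute)
  have du: "\<bar>norm u - norm u'\<bar> \<le> \<delta>" "\<bar>norm (u - v) - norm (u' - v)\<bar> \<le> \<delta>"
    using d by (simp_all add: u_def u'_def v_def dist_norm)
  have sq: "\<bar>a\<^sup>2 - b\<^sup>2\<bar> \<le> 2 * R * \<delta>" if "0 \<le> a" "0 \<le> b" "a \<le> R" "b \<le> R" "\<bar>a - b\<bar> \<le> \<delta>" for a b :: real
  proof -
    have "\<bar>a\<^sup>2 - b\<^sup>2\<bar> = \<bar>a - b\<bar> * (a + b)"
      using that by (simp add: power2_eq_square square_diff_square_factored abs_mult)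
    also have "\<dots> \<le> \<delta> * (2 * R)" using that by (intro mult_mono) auto
    finally show ?thesis by (simp add: mult.commute)
  qed
  define X X' where "X = outer_product u v" and "X' = outer_product u' v"
  have s1: "\<bar>(norm u)\<^sup>2 - (norm u')\<^sup>2\<bar> \<le> 2 * R * \<delta>"
    and s2: "\<bar>(norm (u - v))\<^sup>2 - (norm (u' - v))\<^sup>2\<bar> \<le> 2 * R * \<delta>"
    using nu du by (auto intro!: sq)
  \<comment> \<open>Polarisation: the two squared distances determine the inner product with
    \<open>v\<close>.\<close>
  have "2 * ((u - u') \<bullet> v) = ((norm u)\<^sup>2 - (norm u')\<^sup>2) - ((norm (u - v))\<^sup>2 - (norm (u' - v))\<^sup>2)"
    by (simp add: power2_norm_eq_inner inner_diff_left inner_diff_right inner_commute)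
  with s1 s2 have dot: "\<bar>(u - u') \<bullet> v\<bar> \<le> 2 * R * \<delta>" by linarith
  \<comment> \<open>Lagrange's identity: the outer and inner products with \<open>v\<close> are the
    legs of a right triangle with hypotenuse \<open>norm a * norm v\<close>.\<close>
  have lagrange: "(outer_product a v)\<^sup>2 = (norm a)\<^sup>2 * (norm v)\<^sup>2 - (a \<bullet> v)\<^sup>2" for a
    unfolding outer_product_def power2_norm_eq_inner inner_vec_def sum_2 inner_real_def by algebra
  have cs: "\<bar>a \<bullet> v\<bar> \<le> R * R" if "norm a \<le> R" for a
    using Cauchy_Schwarz_ineq2[of a v] mult_mono[OF that nu(5) R0 norm_ge_zero] by linarith
  have "X\<^sup>2 - X'\<^sup>2 = (norm v)\<^sup>2 * ((norm u)\<^sup>2 - (norm u')\<^sup>2) - ((u - u') \<bullet> v) * (u \<bullet> v + u' \<bullet> v)"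
    unfolding X_def X'_def lagrange inner_diff_left by algebra
  moreover have "\<bar>(norm v)\<^sup>2 * ((norm u)\<^sup>2 - (norm u')\<^sup>2)\<bar> \<le> R\<^sup>2 * (2 * R * \<delta>)"
    unfolding abs_mult using s1 nu(5) by (intro mult_mono) (auto intro: power_mono)
  moreover have "\<bar>((u - u') \<bullet> v) * (u \<bullet> v + u' \<bullet> v)\<bar> \<le> (2 * R * \<delta>) * (2 * (R * R))"
    unfolding abs_mult using dot cs[OF nu(1)] cs[OF nu(2)] R0 assms(2) by (intro mult_mono) auto
  ultimately have "\<bar>X\<^sup>2 - X'\<^sup>2\<bar> \<le> R\<^sup>2 * (2 * R * \<delta>) + (2 * R * \<delta>) * (2 * (R * R))" by linarith
  also have "\<dots> = 6 * R^3 * \<delta>" by (simp add: power2_eq_square power3_eq_cube)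
  finally have XX: "\<bar>X - X'\<bar> * \<bar>X + X'\<bar> \<le> 6 * R^3 * \<delta>"
    by (simp add: power2_eq_square square_diff_square_factored abs_mult mult.commute)
  \<comment> \<open>Equal signs prevent cancellation in the sum. Dividing by it turns closeness of
    the squares into closeness of \<open>X\<close> and \<open>X'\<close>.\<close>
  have "\<bar>X + X'\<bar> \<ge> 2 * r" using T sgn r by (auto simp: X_def X'_def u_def u'_def v_def)
  then have "\<bar>X - X'\<bar> * (2 * r) \<le> 6 * R^3 * \<delta>"
    using XX mult_left_mono[of "2 * r" "\<bar>X + X'\<bar>" "\<bar>X - X'\<bar>"] by linarith
  then have cross: "\<bar>outer_product (u - u') v\<bar> \<le> 3 * R^3 / r * \<delta>"
    using r by (simp add: X_def X'_def outer_product_def field_simps)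
  have "(norm (u - u') * norm v)\<^sup>2 = \<bar>(u - u') \<bullet> v\<bar>\<^sup>2 + \<bar>outer_product (u - u') v\<bar>\<^sup>2"
    by (simp add: lagrange power_mult_distrib)
  also have "\<dots> \<le> (\<bar>(u - u') \<bullet> v\<bar> + \<bar>outer_product (u - u') v\<bar>)\<^sup>2"
    by (simp add: power2_sum)
  finally have "norm (u - u') * norm v \<le> \<bar>(u - u') \<bullet> v\<bar> + \<bar>outer_product (u - u') v\<bar>"
    by (rule power2_le_imp_le) simp
  with dot cross have A: "norm (u - u') * norm v \<le> (2 * R + 3 * R^3 / r) * \<delta>"
    by (simp add: distrib_right)
  \<comment> \<open>The area bound gives \<open>norm v\<close> a positive lower bound, so this
    factor can be removed from \<open>A\<close>.\<close>
  have "r \<le> R * norm v"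
  proof -
    have "X\<^sup>2 \<le> (norm u * norm v)\<^sup>2" by (simp add: X_def lagrange power_mult_distrib)
    then have "\<bar>X\<bar> \<le> norm u * norm v" by (simp add: abs_le_square_iff[symmetric])
    also have "\<dots> \<le> R * norm v" using nu by (intro mult_right_mono) auto
    finally show ?thesis using T(1) by (simp add: X_def u_def v_def)
  qed
  then have "norm (u - u') * r \<le> R * (norm (u - u') * norm v)"
    using mult_left_mono[of r "R * norm v" "norm (u - u')"] by (simp add: ac_simps)
  also have "\<dots> \<le> R * ((2 * R + 3 * R^3 / r) * \<delta>)" using A R0 by (rule mult_left_mono)
  finally have "norm (u - u') \<le> R * ((2 * R + 3 * R^3 / r) * \<delta>) / r"
    using r by (simp add: pos_le_divide_eq)
  then show ?thesis by (simp add: u_def u'_def dist_norm)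
qed

section \<open>Grid classes of lengths and the count of triangles\<close>

lemma eq_floor_divide_imp:
  fixes a b \<delta> :: real
  assumes "\<delta> > 0" "\<lfloor>a / \<delta>\<rfloor> = \<lfloor>b / \<delta>\<rfloor>"
  shows "\<bar>a - b\<bar> \<le> \<delta>"
proof -
  have "\<bar>a / \<delta> - b / \<delta>\<bar> \<le> 1" using assms(2) by linarith
  then have "\<bar>(a - b) / \<delta>\<bar> \<le> 1" by (simp add: diff_divide_distrib)
  then show ?thesis using assms(1) by (simp)
qed


lemma mem_cube_component:
  fixes x a :: "real^'n"
  assumes "x \<in> cube a \<delta>"
  shows "a $ i \<le> x $ i" "x $ i \<le> a $ i + \<delta>"
  using assms unfolding mem_cube_iff by (auto simp: inner_axis axis_in_Basis_iff dest: bspec[of _ _ "axis i 1"])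

text \<open>
  The count of the triangles \<open>pqw\<close> with apex \<open>w \<in> S\<close> adds up over the lengths of \<open>pq\<close>,
  because a cube meets at most two of the grid classes of that length.
\<close>

lemma card_lengths_mult_covering_number_le:
  fixes r R :: real
  assumes r: "r > 0"
  obtains C :: nat where
    "\<And>p Y S (D :: (real^3) set) \<delta> k l m. \<delta> > 0 \<Longrightarrow> bounded D \<Longrightarrow>
       (\<And>q. q \<in> Y \<Longrightarrow> dist p q \<le> R) \<Longrightarrow> (\<And>w. w \<in> S \<Longrightarrow> dist w p \<le> R) \<Longrightarrow>
       (\<And>q w. q \<in> Y \<Longrightarrow> w \<in> S \<Longrightarrow> dist w q \<le> R \<and> \<bar>outer_product (w - p) (q - p)\<bar> > r) \<Longrightarrow>
       (\<And>q w. q \<in> Y \<Longrightarrow> w \<in> S \<Longrightarrow>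
          \<exists>t\<in>D. t $ k = dist p q \<and> t $ l = dist w p \<and> t $ m = dist w q) \<Longrightarrow>
       card ((\<lambda>q. \<lfloor>dist p q / \<delta>\<rfloor>) ` Y) * covering_number \<delta> S \<le> C * covering_number \<delta> D"
proof -
  \<comment> \<open>The Lipschitz constant of \<open>dist_le_of_distances\<close>.\<close>
  define K where "K = R / r * (2 * R + 3 * R^3 / r)"
  obtain M :: nat where M:
    "\<And>(A :: (real^2) set) \<delta> (g :: real^2 \<Rightarrow> (real^3) \<times> bool) L. \<delta> > 0 \<Longrightarrow> finite L \<Longrightarrow> g ` A \<subseteq> L \<Longrightarrow>
       (\<And>w w'. w \<in> A \<Longrightarrow> w' \<in> A \<Longrightarrow> g w = g w' \<Longrightarrow> dist w w' \<le> K * \<delta>) \<Longrightarrow>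
       covering_number \<delta> A \<le> M * card L"
    using covering_number_le_labels by blast
  show ?thesis
  \<comment> \<open>One factor 2 stands for the two orientations of a triangle, the other for the
    two grid classes that a cube can meet.\<close>
  proof (rule that[of "4 * M"])
    fix p :: "real^2" and Y S and D :: "(real^3) set" and \<delta> :: real and k l m :: 3
    assume \<delta>: "\<delta> > 0" and D: "bounded D"
      and Y: "\<And>q. q \<in> Y \<Longrightarrow> dist p q \<le> R" and S: "\<And>w. w \<in> S \<Longrightarrow> dist w p \<le> R"
      and YS: "\<And>q w. q \<in> Y \<Longrightarrow> w \<in> S \<Longrightarrow> dist w q \<le> R \<and> \<bar>outer_product (w - p) (q - p)\<bar> > r"
      and ex: "\<And>q w. q \<in> Y \<Longrightarrow> w \<in> S \<Longrightarrow>
          \<exists>t\<in>D. t $ k = dist p q \<and> t $ l = dist w p \<and> t $ m = dist w q"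
    obtain P where P: "finite P" "card P = covering_number \<delta> D" "D \<subseteq> (\<Union>a\<in>P. cube a \<delta>)"
      using covering_number_attained[OF D \<delta>] by blast
    have "\<exists>c\<in>P. \<exists>t\<in>cube c \<delta>. t $ k = dist p q \<and> t $ l = dist w p \<and> t $ m = dist w q"
      if "q \<in> Y" "w \<in> S" for q w
      using ex[OF that] P(3) by blast
    \<comment> \<open>For each pair, a cube of an optimal cover that holds its triple is fixed;
      \<open>c q w\<close> is the lower corner.\<close>
    then obtain c t where c: "\<And>q w. q \<in> Y \<Longrightarrow> w \<in> S \<Longrightarrow> c q w \<in> P \<and> t q w \<in> cube (c q w) \<delta> \<and>
        t q w $ k = dist p q \<and> t q w $ l = dist w p \<and> t q w $ m = dist w q"
      by metis
    \<comment> \<open>With \<open>q\<close> fixed, \<open>w\<close> is labelled by its cube and its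
      orientation: triples in one cube agree within \<delta> in the coordinates \<open>l\<close> and
      \<open>m\<close>, the distances from \<open>w\<close> to \<open>p\<close> and
      \<open>q\<close>.\<close>
    have fibre: "covering_number \<delta> S \<le> 2 * M * card (c q ` S)" if q: "q \<in> Y" for q
    proof -
      have fin: "finite (c q ` S)" by (rule finite_subset[OF _ P(1)]) (use c q in blast)
      have "covering_number \<delta> S \<le> M * card ((c q ` S) \<times> (UNIV :: bool set))"
      proof (rule M[OF \<delta>, where g = "\<lambda>w. (c q w, outer_product (w - p) (q - p) > 0)"])
        fix w w' assume w: "w \<in> S" "w' \<in> S"
          and eq: "(c q w, outer_product (w - p) (q - p) > 0) = (c q w', outer_product (w' - p) (q - p) > 0)"
        have mem: "t q w \<in> cube (c q w) \<delta>" "t q w' \<in> cube (c q w) \<delta>" using c[OF q w(1)] c[OF q w(2)] eq by simp_all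
        have close: "\<bar>t q w $ i - t q w' $ i\<bar> \<le> \<delta>" for i
          using mem_cube_component[OF mem(1), of i] mem_cube_component[OF mem(2), of i] by linarith
        show "dist w w' \<le> K * \<delta>"
          unfolding K_def
        proof (rule dist_le_of_distances[OF r])
          show "\<bar>dist w p - dist w' p\<bar> \<le> \<delta>" "\<bar>dist w q - dist w' q\<bar> \<le> \<delta>"
            using close[of l] close[of m] c q w by auto
        qed (use \<delta> Y S YS q w eq in auto)
      qed (use fin in auto)
      then show ?thesis by (simp add: card_cartesian_product)
    qed
    define I where "I = (\<lambda>q. \<lfloor>dist p q / \<delta>\<rfloor>) ` Y"
    \<comment> \<open>One base endpoint is kept for each length class.\<close>
    define y where "y = inv_into Y (\<lambda>q. \<lfloor>dist p q / \<delta>\<rfloor>)"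
    have y: "y i \<in> Y" "\<lfloor>dist p (y i) / \<delta>\<rfloor> = i" if "i \<in> I" for i
      using that unfolding I_def y_def
    by (rule inv_into_into, rule f_inv_into_f[where f = "\<lambda>q. \<lfloor>dist p q / \<delta>\<rfloor>"])
    have "I \<subseteq> {0..\<lfloor>R / \<delta>\<rfloor>}"
      using Y \<delta> by (auto simp: I_def intro!: floor_mono divide_right_mono)
    then have I: "finite I" using finite_subset by blast
    have fin: "finite (c (y i) ` S)" if "i \<in> I" for i
      by (rule finite_subset[OF _ P(1)]) (use c y(1)[OF that] in blast)
    \<comment> \<open>The offset between \<open>i\<close> and the class of the corner coordinate
      \<open>b $ k\<close> determines \<open>i\<close> once \<open>b\<close> is known, so
      \<open>h\<close> is injective. The cube has side \<delta>, so the offset is 0 or 1.\<close>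
    define h where "h = (\<lambda>(i, b :: real^3). (b, i - \<lfloor>b $ k / \<delta>\<rfloor>))"
    have "h ` (SIGMA i:I. c (y i) ` S) \<subseteq> P \<times> {0, 1}"
    proof
      fix e assume "e \<in> h ` (SIGMA i:I. c (y i) ` S)"
      then obtain i w where i: "i \<in> I" and w: "w \<in> S" and e: "e = h (i, c (y i) w)" by auto
      define b where "b = c (y i) w"
      note cw = c[OF y(1)[OF i] w, folded b_def]
      have "b $ k \<le> dist p (y i)" "dist p (y i) \<le> b $ k + \<delta>"
        using mem_cube_component[of "t (y i) w" b \<delta> k] cw by auto
      then have "b $ k / \<delta> \<le> dist p (y i) / \<delta>" "dist p (y i) / \<delta> \<le> b $ k / \<delta> + 1"
        using \<delta> by (simp_all add: field_simps)
      then have "i - \<lfloor>b $ k / \<delta>\<rfloor> \<in> {0, 1}"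
        using y(2)[OF i] by (simp add: disj_commute) linarith
      then show "e \<in> P \<times> {0, 1}" using cw by (simp add: e h_def b_def)
    qed
    moreover have "inj_on h (SIGMA i:I. c (y i) ` S)" by (auto simp: inj_on_def h_def)
    ultimately have "card (SIGMA i:I. c (y i) ` S) \<le> card (P \<times> {0, 1 :: int})"
      using P(1) by (intro card_inj_on_le[of h]) auto
    then have count: "(\<Sum>i\<in>I. card (c (y i) ` S)) \<le> 2 * card P"
      using I fin by (simp add: card_cartesian_product)
    have "card I * covering_number \<delta> S = (\<Sum>i\<in>I. covering_number \<delta> S)" by simp
    also have "\<dots> \<le> (\<Sum>i\<in>I. 2 * M * card (c (y i) ` S))" using fibre y(1) by (intro sum_mono) auto
    also have "\<dots> = 2 * M * (\<Sum>i\<in>I. card (c (y i) ` S))" by (simp add: sum_distrib_left)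
    also have "\<dots> \<le> 2 * M * (2 * card P)" using count by (rule mult_le_mono2)
    finally show "card ((\<lambda>q. \<lfloor>dist p q / \<delta>\<rfloor>) ` Y) * covering_number \<delta> S \<le> 4 * M * covering_number \<delta> D"
      by (simp add: I_def P(2))
  qed
qed

section \<open>The product inequality for the triangle set\<close>

lemma bounded_triangle_set:
  assumes "bounded F"
  shows "bounded (triangle_set F)"
proof -
  obtain R where R: "\<And>x y. x \<in> F \<Longrightarrow> y \<in> F \<Longrightarrow> dist x y \<le> R"
    using assms unfolding bounded_two_points by blast
  have "norm t \<le> 3 * R" if "t \<in> triangle_set F" for t
  proof -
    have "\<bar>t $ 1\<bar> \<le> R" "\<bar>t $ 2\<bar> \<le> R" "\<bar>t $ 3\<bar> \<le> R"
      using that R unfolding triangle_set_def dist_norm by auto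
    then show ?thesis using norm_le_l1_cart[of t] by (simp add: sum_3)
  qed
  then show ?thesis by (auto simp: bounded_iff)
qed

lemma triangle_set_memI:
  assumes "x \<in> F" "y \<in> F" "z \<in> F"
  shows "\<exists>t\<in>triangle_set F. t $ 1 = dist x y \<and> t $ 2 = dist z y \<and> t $ 3 = dist x z"
  using assms
  by (intro bexI[of _ "vector [dist x y, dist z y, dist x z]"])
    (auto simp: triangle_set_def vector_3 forall_3 dist_norm)

text \<open>Two lower bounds for the triangle set, one per counted side, are multiplied; the unknown
  numbers of lengths then cancel against the upper bound for \<open>F2\<close>. The constant is
  chosen before \<delta>.\<close>

lemma covering_numbers_mult_le:
  assumes F: "bounded F" and sep: "bilinearly_separated_triple F F1 F2 F3"
  shows "\<exists>C>0. \<forall>\<delta>>0. covering_number \<delta> F1 * covering_number \<delta> F2 * covering_number \<delta> F3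
           \<le> C * (covering_number \<delta> (triangle_set F))\<^sup>2"
proof (cases "F1 = {} \<or> F3 = {}")
  \<comment> \<open>Without a point in \<open>F1\<close> or in \<open>F3\<close> there is no vertex
    to fix, but then the product vanishes.\<close>
  case True
  then show ?thesis by (intro exI[of _ 1]) auto
next
  case False
  then obtain x z where x: "x \<in> F1" and z: "z \<in> F3" by blast
  obtain r where r: "r > 0" and sub: "F1 \<subseteq> F" "F2 \<subseteq> F" "F3 \<subseteq> F"
    and outer: "\<And>x y z. x \<in> F1 \<Longrightarrow> y \<in> F2 \<Longrightarrow> z \<in> F3 \<Longrightarrow> \<bar>outer_product (x - y) (y - z)\<bar> > r"
    using sep unfolding bilinearly_separated_triple_def by auto
  obtain R where R: "\<And>x y. x \<in> F \<Longrightarrow> y \<in> F \<Longrightarrow> dist x y \<le> R"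
    using F unfolding bounded_two_points by blast
  note bd = bounded_triangle_set[OF F]
  obtain C :: nat where C:
    "\<And>p Y S (D :: (real^3) set) \<delta> k l m. \<delta> > 0 \<Longrightarrow> bounded D \<Longrightarrow>
       (\<And>q. q \<in> Y \<Longrightarrow> dist p q \<le> R) \<Longrightarrow> (\<And>w. w \<in> S \<Longrightarrow> dist w p \<le> R) \<Longrightarrow>
       (\<And>q w. q \<in> Y \<Longrightarrow> w \<in> S \<Longrightarrow> dist w q \<le> R \<and> \<bar>outer_product (w - p) (q - p)\<bar> > r) \<Longrightarrow>
       (\<And>q w. q \<in> Y \<Longrightarrow> w \<in> S \<Longrightarrow>
          \<exists>t\<in>D. t $ k = dist p q \<and> t $ l = dist w p \<and> t $ m = dist w q) \<Longrightarrow>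
       card ((\<lambda>q. \<lfloor>dist p q / \<delta>\<rfloor>) ` Y) * covering_number \<delta> S \<le> C * covering_number \<delta> D"
    using card_lengths_mult_covering_number_le[OF r] by blast
  define K where "K = R / r * (2 * R + 3 * R^3 / r)"
  obtain M :: nat where M:
    "\<And>(A :: (real^2) set) \<delta> (g :: real^2 \<Rightarrow> int \<times> int \<times> bool) L. \<delta> > 0 \<Longrightarrow> finite L \<Longrightarrow> g ` A \<subseteq> L \<Longrightarrow>
       (\<And>w w'. w \<in> A \<Longrightarrow> w' \<in> A \<Longrightarrow> g w = g w' \<Longrightarrow> dist w w' \<le> K * \<delta>) \<Longrightarrow>
       covering_number \<delta> A \<le> M * card L"
    using covering_number_le_labels by blast
  \<comment> \<open>Up to sign, all these expressions are twice the area of the same triangle, so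
    one \<open>r\<close> serves every choice of vertex.\<close>
  have area: "\<bar>outer_product (z - x) (y - x)\<bar> > r" "\<bar>outer_product (x - z) (y - z)\<bar> > r"
    "\<bar>outer_product (y - x) (z - x)\<bar> > r" if "x \<in> F1" "y \<in> F2" "z \<in> F3" for x y z
    using outer[OF that] by (simp_all add: outer_product_def algebra_simps abs_if split: if_splits)
  note mem = subsetD[OF sub(1)] subsetD[OF sub(2)] subsetD[OF sub(3)]
  have "covering_number \<delta> F1 * covering_number \<delta> F2 * covering_number \<delta> F3
      \<le> (2 * M * C\<^sup>2) * (covering_number \<delta> (triangle_set F))\<^sup>2" if \<delta>: "\<delta> > 0" for \<delta>
  proof -
    define A where "A = (\<lambda>y. \<lfloor>dist x y / \<delta>\<rfloor>) ` F2"
    define B where "B = (\<lambda>y. \<lfloor>dist z y / \<delta>\<rfloor>) ` F2"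
    let ?N = "covering_number \<delta> (triangle_set F)"
    \<comment> \<open>Here \<open>x\<close> is fixed, the lengths of \<open>xy\<close> are counted
      and the apex \<open>z\<close> runs through \<open>F3\<close>; in \<open>n1\<close> the roles
      of \<open>x\<close> and \<open>z\<close> are exchanged. The index \<open>k\<close> selects the
      counted side, \<open>l\<close> and \<open>m\<close> the sides at the apex.\<close>
    have n3: "card A * covering_number \<delta> F3 \<le> C * ?N"
      unfolding A_def
    proof (rule C[OF \<delta> bd, where k = 1 and l = 3 and m = 2])
      fix y z assume "y \<in> F2" "z \<in> F3"
      then show "\<exists>t\<in>triangle_set F. t $ 1 = dist x y \<and> t $ 3 = dist z x \<and> t $ 2 = dist z y"
        using triangle_set_memI[of x F y z] x sub by (auto simp: dist_commute)
    qed (auto intro: R mem x z area)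
    have n1: "card B * covering_number \<delta> F1 \<le> C * ?N"
      unfolding B_def
    proof (rule C[OF \<delta> bd, where k = 2 and l = 3 and m = 1])
      fix y x assume "y \<in> F2" "x \<in> F1"
      then show "\<exists>t\<in>triangle_set F. t $ 2 = dist z y \<and> t $ 3 = dist x z \<and> t $ 1 = dist x y"
        using triangle_set_memI[of x F y z] z sub by (auto simp: dist_commute)
    qed (auto intro: R mem x z area)
    have "dist x y \<le> R" "dist z y \<le> R" if "y \<in> F2" for y
      using that x z sub by (auto intro!: R)
    then have "A \<subseteq> {0..\<lfloor>R / \<delta>\<rfloor>}" "B \<subseteq> {0..\<lfloor>R / \<delta>\<rfloor>}"
      using \<delta> by (auto simp: A_def B_def intro!: floor_mono divide_right_mono)
    then have fin: "finite A" "finite B" using finite_subset by blast+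
    \<comment> \<open>A point of \<open>F2\<close> is labelled by its two grid classes and its side
      of the line \<open>xz\<close>.\<close>
    have "covering_number \<delta> F2 \<le> M * card (A \<times> B \<times> (UNIV :: bool set))"
    proof (rule M[OF \<delta>, where g = "\<lambda>y. (\<lfloor>dist x y / \<delta>\<rfloor>, \<lfloor>dist z y / \<delta>\<rfloor>, outer_product (y - x) (z - x) > 0)"])
      fix y y' assume y: "y \<in> F2" "y' \<in> F2"
        and eq: "(\<lfloor>dist x y / \<delta>\<rfloor>, \<lfloor>dist z y / \<delta>\<rfloor>, outer_product (y - x) (z - x) > 0) =
          (\<lfloor>dist x y' / \<delta>\<rfloor>, \<lfloor>dist z y' / \<delta>\<rfloor>, outer_product (y' - x) (z - x) > 0)"
      show "dist y y' \<le> K * \<delta>"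
        unfolding K_def
      proof (rule dist_le_of_distances[OF r])
        show "\<bar>dist y x - dist y' x\<bar> \<le> \<delta>" "\<bar>dist y z - dist y' z\<bar> \<le> \<delta>"
          using eq_floor_divide_imp[OF \<delta>, of "dist x y" "dist x y'"]
            eq_floor_divide_imp[OF \<delta>, of "dist z y" "dist z y'"] eq by (auto simp: dist_commute)
        show "\<bar>outer_product (y - x) (z - x)\<bar> > r" "\<bar>outer_product (y' - x) (z - x)\<bar> > r"
          using area x y z by auto
      qed (use \<delta> x y z eq in \<open>auto intro: R mem\<close>)
    qed (use fin in \<open>auto simp: A_def B_def\<close>)
    then have n2: "covering_number \<delta> F2 \<le> 2 * M * (card A * card B)"
      by (simp add: card_cartesian_product)
    have "covering_number \<delta> F1 * covering_number \<delta> F2 * covering_number \<delta> F3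
        \<le> covering_number \<delta> F1 * (2 * M * (card A * card B)) * covering_number \<delta> F3"
      using n2 by (intro mult_le_mono) auto
    also have "\<dots> = 2 * M * ((card A * covering_number \<delta> F3) * (card B * covering_number \<delta> F1))"
      by (simp add: ac_simps)
    also have "\<dots> \<le> 2 * M * ((C * ?N) * (C * ?N))"
      by (intro mult_le_mono le_refl n1 n3)
    also have "\<dots> = (2 * M * C\<^sup>2) * ?N\<^sup>2" by (simp add: power2_eq_square)
    finally show ?thesis .
  qed
  \<comment> \<open>\<open>Suc\<close> makes the constant positive even if \<open>M\<close> or
    \<open>C\<close> is 0.\<close>
  then show ?thesis
    by (intro exI[of _ "Suc (2 * M * C\<^sup>2)"]) (auto intro: trans_le_add2)
qed

section \<open>From covering numbers to box dimensions\<close>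

lemma lower_box_dim_empty [simp]: "lower_box_dim {} = - \<infinity>"
  by (simp add: lower_box_dim_def box_quotient_def[abs_def] Liminf_const)

lemma upper_box_dim_empty [simp]: "upper_box_dim {} = - \<infinity>"
  by (simp add: upper_box_dim_def box_quotient_def[abs_def] Limsup_const)

text \<open>Logarithms turn the exponents 3 and 2 into the factor 3/2, and the constant
  \<open>c\<close> into an error of order \<open>1 / (- ln \<delta>)\<close>.\<close>

lemma quotient_le_of_cube_le:
  fixes n k :: nat
  assumes \<delta>: "0 < \<delta>" "\<delta> < 1" and n: "n > 0" and c: "c > 0"
    and le: "real n ^ 3 \<le> c * real k ^ 2"
  shows "3/2 * (- (ln (real n) / ln \<delta>)) \<le> - (ln (real k) / ln \<delta>) + (ln c / 2) / (- ln \<delta>)"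
proof -
  have k: "k > 0" using le n by (cases "k = 0") auto
  have "ln (real n ^ 3) \<le> ln (c * real k ^ 2)" using le n by (intro ln_mono) auto
  then have "3 * ln (real n) \<le> ln c + 2 * ln (real k)"
    using n k c by (simp add: ln_mult ln_realpow)
  then have "(3/2 * ln (real n)) / (- ln \<delta>) \<le> (ln (real k) + ln c / 2) / (- ln \<delta>)"
    using \<delta> by (intro divide_right_mono) auto
  then show ?thesis by (simp add: add_divide_distrib)
qed

lemma eventually_const_div_ln_less:
  assumes "e > 0"
  shows "\<forall>\<^sub>F \<delta> in at_right (0::real). c / (- ln \<delta>) < e"
proof -
  have "((\<lambda>\<delta>. c / (- ln \<delta>)) \<longlongrightarrow> 0) (at_right (0::real))"
    by (rule tendsto_divide_0[OF tendsto_const])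
      (auto intro!: filterlim_at_top_imp_at_infinity simp: filterlim_uminus_at_top ln_at_0)
  then show ?thesis using assms by (rule order_tendstoD)
qed

text \<open>Near 0 the error is below any \<open>e > 0\<close>, so it disappears in both limits:
  constant factors in covering numbers do not affect dimensions.\<close>

lemma Liminf_Limsup_le_of_error:
  fixes f g :: "real \<Rightarrow> ereal"
  assumes "\<And>\<delta>. 0 < \<delta> \<Longrightarrow> \<delta> < 1 \<Longrightarrow> f \<delta> \<le> g \<delta> + ereal (c / (- ln \<delta>))"
  shows "Liminf (at_right 0) f \<le> Liminf (at_right 0) g"
    and "Limsup (at_right 0) f \<le> Limsup (at_right 0) g"
proof -
  have ev: "\<forall>\<^sub>F \<delta> in at_right 0. f \<delta> \<le> g \<delta> + ereal e" if "e > 0" for e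
  proof -
    have "\<forall>\<^sub>F \<delta> in at_right 0. \<delta> \<in> {0<..<1::real}" by (rule eventually_at_right_real) simp
    with eventually_const_div_ln_less[OF that, of c] show ?thesis
    proof eventually_elim
      case (elim \<delta>)
      have "f \<delta> \<le> g \<delta> + ereal (c / (- ln \<delta>))" using elim by (intro assms) auto
      also have "\<dots> \<le> g \<delta> + ereal e" using elim by (intro add_left_mono) simp
      finally show ?case .
    qed
  qed
  show "Liminf (at_right 0) f \<le> Liminf (at_right 0) g"
  proof (rule ereal_le_epsilon2)
    fix e :: real assume "e > 0"
    from Liminf_mono[OF ev[OF this]]
    show "Liminf (at_right 0) f \<le> Liminf (at_right 0) g + ereal e"
      by (subst (asm) Liminf_add_ereal_right) auto
  qed
  show "Limsup (at_right 0) f \<le> Limsup (at_right 0) g"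
  proof (rule ereal_le_epsilon2)
    fix e :: real assume "e > 0"
    from Limsup_mono[OF ev[OF this]]
    show "Limsup (at_right 0) f \<le> Limsup (at_right 0) g + ereal e"
      by (subst (asm) Limsup_add_ereal_right) auto
  qed
qed

text \<open>Carries the real estimate over to \<open>box_quotient\<close>; if \<open>A\<close> has
  covering number 0, the left side is minus infinity.\<close>

lemma box_quotient_le_of_cube_le:
  assumes \<delta>: "0 < \<delta>" "\<delta> < 1" and c: "c > 0" and k: "covering_number \<delta> D > 0"
    and le: "real (covering_number \<delta> A) ^ 3 \<le> c * real (covering_number \<delta> D) ^ 2"
  shows "ereal (3/2) * box_quotient A \<delta> \<le> box_quotient D \<delta> + ereal ((ln c / 2) / (- ln \<delta>))"
proof (cases "covering_number \<delta> A = 0")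
  case True
  then show ?thesis by (simp add: box_quotient_def)
next
  case False
  then show ?thesis
    using quotient_le_of_cube_le[OF \<delta> _ c le] k by (simp add: box_quotient_def)
qed

text \<open>Anything below all three lower limits is eventually below each function, hence below
  their pointwise minimum.\<close>

lemma le_Liminf_min3:
  fixes f1 f2 f3 :: "'a \<Rightarrow> ereal"
  shows "min (Liminf F f1) (min (Liminf F f2) (Liminf F f3)) \<le> Liminf F (\<lambda>x. min (f1 x) (min (f2 x) (f3 x)))"
  unfolding le_Liminf_iff
proof safe
  fix y assume "y < min (Liminf F f1) (min (Liminf F f2) (Liminf F f3))"
  then have "\<forall>\<^sub>F x in F. y < f1 x" "\<forall>\<^sub>F x in F. y < f2 x" "\<forall>\<^sub>F x in F. y < f3 x"
    by (auto intro: less_LiminfD)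
  then show "\<forall>\<^sub>F x in F. y < min (f1 x) (min (f2 x) (f3 x))" by eventually_elim simp
qed

section \<open>Dimension bounds under weak and strong separation\<close>

theorem theorem1p2:
  fixes F :: "(real^2) set"
  assumes "compact F"
  shows "(weak_bilinearly_separated F \<longrightarrow>
            upper_box_dim (triangle_set F) \<ge> ereal (3/2) * lower_box_dim F) \<and>
         (strong_bilinearly_separated F \<longrightarrow>
            lower_box_dim (triangle_set F) \<ge> ereal (3/2) * lower_box_dim F \<and>
            upper_box_dim (triangle_set F) \<ge> ereal (3/2) * upper_box_dim F)"
proof (cases "F = {}")
  case True
  then show ?thesis by simp
next
  case False
  let ?D = "triangle_set F"
  have F: "bounded F" using assms by (rule compact_imp_bounded)
  then have "bounded ?D" by (rule bounded_triangle_set)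
  moreover have "?D \<noteq> {}" using False triangle_set_memI by blast
  \<comment> \<open>Positivity keeps the quotient of the triangle set finite, as the logarithmic
    estimate requires.\<close>
  ultimately have D: "covering_number \<delta> ?D > 0" if "\<delta> > 0" for \<delta>
    using that covering_number_pos by blast
  have weak: "ereal (3/2) * lower_box_dim F \<le> upper_box_dim ?D" if "weak_bilinearly_separated F"
  proof -
    from that obtain F1 F2 F3 where sep: "bilinearly_separated_triple F F1 F2 F3"
      and min: "Min {lower_box_dim F1, lower_box_dim F2, lower_box_dim F3} = lower_box_dim F"
      unfolding weak_bilinearly_separated_def by blast
    obtain C where C: "C > 0" "\<And>\<delta>. \<delta> > 0 \<Longrightarrow> covering_number \<delta> F1 * covering_number \<delta> F2 *
        covering_number \<delta> F3 \<le> C * (covering_number \<delta> ?D)\<^sup>2"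
      using covering_numbers_mult_le[OF F sep] by blast
    \<comment> \<open>Which of the three sets has the least covering number may change with
      \<delta>, so the limit is taken of the pointwise minimum.\<close>
    let ?q = "\<lambda>\<delta>. min (box_quotient F1 \<delta>) (min (box_quotient F2 \<delta>) (box_quotient F3 \<delta>))"
    have q: "ereal (3/2) * ?q \<delta> \<le> box_quotient ?D \<delta> + ereal ((ln (real C) / 2) / (- ln \<delta>))"
      if \<delta>: "0 < \<delta>" "\<delta> < 1" for \<delta>
    proof -
      let ?n = "\<lambda>A :: (real^2) set. covering_number \<delta> A"
      \<comment> \<open>The smallest of the three at this scale: the cube of its covering number is
        at most the product.\<close>
      obtain A where A: "A \<in> {F1, F2, F3}" "?n A \<le> ?n F1" "?n A \<le> ?n F2" "?n A \<le> ?n F3"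
        using ex_is_arg_min_if_finite[of "{F1, F2, F3}" ?n] by (auto simp: is_arg_min_linorder)
      have "?n A ^ 3 \<le> ?n F1 * ?n F2 * ?n F3"
        unfolding power3_eq_cube using A by (intro mult_le_mono) auto
      then have "?n A ^ 3 \<le> C * (covering_number \<delta> ?D)\<^sup>2" using C(2)[OF \<delta>(1)] by linarith
      then have "real (?n A) ^ 3 \<le> real C * real (covering_number \<delta> ?D) ^ 2"
        unfolding of_nat_power[symmetric] of_nat_mult[symmetric] of_nat_le_iff .
      then have "ereal (3/2) * box_quotient A \<delta> \<le> box_quotient ?D \<delta> + ereal ((ln (real C) / 2) / (- ln \<delta>))"
        using \<delta> C(1) D by (intro box_quotient_le_of_cube_le) auto
      moreover have "?q \<delta> \<le> box_quotient A \<delta>" using A(1) by (auto simp: min_le_iff_disj)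
      then have "ereal (3/2) * ?q \<delta> \<le> ereal (3/2) * box_quotient A \<delta>"
        by (intro ereal_mult_left_mono) auto
      ultimately show ?thesis by (rule order_trans[rotated])
    qed
    have "lower_box_dim F \<le> Liminf (at_right 0) ?q"
      using le_Liminf_min3[of "at_right 0" "box_quotient F1" "box_quotient F2" "box_quotient F3"] min
      by (simp add: lower_box_dim_def)
    then have "ereal (3/2) * lower_box_dim F \<le> ereal (3/2) * Liminf (at_right 0) ?q"
      by (intro ereal_mult_left_mono) auto
    also have "\<dots> = Liminf (at_right 0) (\<lambda>\<delta>. ereal (3/2) * ?q \<delta>)"
      by (rule Liminf_ereal_mult_left[symmetric]) auto
    \<comment> \<open>This already bounds the lower box dimension of the triangle set from below;
      the upper one is at least as large.\<close>
    also have "\<dots> \<le> Liminf (at_right 0) (box_quotient ?D)"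
      using q by (rule Liminf_Limsup_le_of_error(1))
    also have "\<dots> \<le> upper_box_dim ?D"
      unfolding upper_box_dim_def by (rule Liminf_le_Limsup) simp
    finally show ?thesis .
  qed
  have strong: "ereal (3/2) * lower_box_dim F \<le> lower_box_dim ?D \<and>
      ereal (3/2) * upper_box_dim F \<le> upper_box_dim ?D" if "strong_bilinearly_separated F"
  proof -
    from that obtain F1 F2 F3 M where sep: "bilinearly_separated_triple F F1 F2 F3" and M: "M > 0"
      and le: "\<And>\<delta>. \<delta> \<in> {0<..<1} \<Longrightarrow> real (covering_number \<delta> F) \<le>
         M * real (Min {covering_number \<delta> F1, covering_number \<delta> F2, covering_number \<delta> F3})"
      unfolding strong_bilinearly_separated_def by blast
    obtain C where C: "C > 0" "\<And>\<delta>. \<delta> > 0 \<Longrightarrow> covering_number \<delta> F1 * covering_number \<delta> F2 *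
        covering_number \<delta> F3 \<le> C * (covering_number \<delta> ?D)\<^sup>2"
      using covering_numbers_mult_le[OF F sep] by blast
    \<comment> \<open>Here \<open>F\<close> itself satisfies the inequality at every scale, with
      \<open>M ^ 3\<close> from comparing it with the three parts, so both the lower and the upper
      limit can be taken.\<close>
    have q: "ereal (3/2) * box_quotient F \<delta> \<le> box_quotient ?D \<delta> + ereal ((ln (M ^ 3 * real C) / 2) / (- ln \<delta>))"
      if \<delta>: "0 < \<delta>" "\<delta> < 1" for \<delta>
    proof (rule box_quotient_le_of_cube_le[OF \<delta>])
      let ?m = "Min {covering_number \<delta> F1, covering_number \<delta> F2, covering_number \<delta> F3}"
      have "real (covering_number \<delta> F) ^ 3 \<le> (M * real ?m) ^ 3"
        using le[of \<delta>] \<delta> by (intro power_mono) auto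
      also have "\<dots> = M ^ 3 * real (?m ^ 3)" by (simp add: power_mult_distrib)
      also have "?m ^ 3 \<le> covering_number \<delta> F1 * covering_number \<delta> F2 * covering_number \<delta> F3"
        unfolding power3_eq_cube by (intro mult_le_mono) auto
      also have "\<dots> \<le> C * (covering_number \<delta> ?D)\<^sup>2" using C(2) \<delta> by blast
      finally show "real (covering_number \<delta> F) ^ 3 \<le> (M ^ 3 * real C) * real (covering_number \<delta> ?D) ^ 2"
        using M by (simp add: mult.assoc)
    qed (use M C D \<delta> in auto)
    show ?thesis
      using Liminf_Limsup_le_of_error[OF q]
      by (simp add: lower_box_dim_def upper_box_dim_def Liminf_ereal_mult_left Limsup_ereal_mult_left)
  qed
  show ?thesis using weak strong by blast
qed

end
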